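(* Let $(M,<)$ be an ordered loopless matroid. Then the set of nbc bases of $M$ is an order ideal (down-closed subset) of the poset $\mathrm{Int}_<(M)$.
   Context: An ordered matroid $(M,<)$ is a matroid on a ground set $E$ together with a total order $<$ on $E$. A broken circuit is a set $C\setminus\{\min C\}$ for a circuit $C$ of $M$. A basis is an nbc basis if it contains no broken circuit. For a basis $B$, an element $b\in B$ is internally passive if there exists $b'<b$ with $(B\setminus\{b\})\cup\{b'\}$ a basis; $IP(B)$ denotes the set of internally passive elements of $B$. $\mathrm{Int}_<(M)$ is the poset on the set of bases of $M$ in which $B\le B'$ if and only if $IP(B)\subseteq IP(B')$. *)

theory Defs
  imports Main
begin

locale matroid =
  fixes E :: "'a set" and indep :: "'a set \<Rightarrow> bool"
  assumes finite_ground: "finite E"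
    and indep_ground: "indep X \<Longrightarrow> X \<subseteq> E"
    and indep_empty: "indep {}"
    and indep_subset: "indep X \<Longrightarrow> Y \<subseteq> X \<Longrightarrow> indep Y"
    and augmentation:
      "indep X \<Longrightarrow> indep Y \<Longrightarrow> card X < card Y \<Longrightarrow> \<exists>y\<in>Y - X. indep (insert y X)"
begin

definition basis :: "'a set \<Rightarrow> bool" where
  "basis B \<longleftrightarrow> indep B \<and> (\<forall>X. indep X \<longrightarrow> B \<subseteq> X \<longrightarrow> X = B)"

definition circuit :: "'a set \<Rightarrow> bool" where
  "circuit C \<longleftrightarrow> C \<subseteq> E \<and> \<not> indep C \<and> (\<forall>X. X \<subset> C \<longrightarrow> indep X)"

definition loopless :: bool where
  "loopless \<longleftrightarrow> (\<forall>e\<in>E. \<not> circuit {e})"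

lemma indep_finite: "indep X \<Longrightarrow> finite X"
  using finite_ground indep_ground finite_subset by blast

lemma extend:
  assumes "indep X" "indep Z" "card X \<le> card Z"
  shows "\<exists>Y. indep Y \<and> X \<subseteq> Y \<and> Y \<subseteq> X \<union> Z \<and> card Y = card Z"
  using assms
proof (induction "card Z - card X" arbitrary: X)
  case 0
  then have "card X = card Z" by simp
  with 0 show ?case by blast
next
  case (Suc n)
  then have "card X < card Z" by simp
  with Suc obtain y where y: "y \<in> Z - X" "indep (insert y X)"
    using augmentation by blast
  then have c: "card (insert y X) = Suc (card X)"
    using Suc indep_finite by auto
  with Suc have "n = card Z - card (insert y X)" "card (insert y X) \<le> card Z" by auto
  from Suc(1)[OF this(1) y(2) Suc(4) this(2)] show ?case using y by blast
qed

lemma indep_card_le_basis: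
  assumes "basis B" "indep X" shows "card X \<le> card B"
proof (rule ccontr)
  assume "\<not> card X \<le> card B"
  then obtain y where "y \<in> X - B" "indep (insert y B)"
    using augmentation assms unfolding basis_def by (meson not_le)
  then show False using assms unfolding basis_def by blast
qed

lemma basis_if_card:
  assumes "basis B" "indep X" "card X = card B" shows "basis X"
  unfolding basis_def
proof (intro conjI allI impI)
  fix Y assume "indep Y" "X \<subseteq> Y"
  then show "Y = X"
    using card_seteq[of Y X] indep_card_le_basis[OF assms(1), of Y] indep_finite[of Y] assms(3)
    by simp
qed fact

lemma basis_exchange:
  assumes B: "basis B" and B': "basis B'" and e: "e \<in> B - B'"
  shows "\<exists>f\<in>B' - B. basis (insert e (B' - {f}))"
proof -
  have i: "indep B'" "indep B" using B B' by (auto simp: basis_def)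
  have X: "indep (insert e (B \<inter> B'))"
    using e by (intro indep_subset[OF i(2)]) auto
  obtain Y where Y: "indep Y" "insert e (B \<inter> B') \<subseteq> Y" "Y \<subseteq> insert e (B \<inter> B') \<union> B'"
      "card Y = card B'"
    using extend[OF X i(1) indep_card_le_basis[OF B' X]] by blast
  have fin: "finite B'" "finite Y" using i Y indep_finite by auto
  have "\<not> B' \<subseteq> Y" using fin Y e card_seteq[of Y B'] by auto
  then obtain f where f: "f \<in> B'" "f \<notin> Y" by blast
  have "Y \<subseteq> insert e (B' - {f})" using Y f by auto
  moreover have "card (insert e (B' - {f})) = card Y"
    using fin f e Y(4) card_Suc_Diff1[of B' f] by simp
  ultimately have "Y = insert e (B' - {f})" using fin by (intro card_subset_eq) auto
  moreover have "basis Y" using basis_if_card[OF B' Y(1,4)] .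
  ultimately show ?thesis using f Y by auto
qed

end

locale ordered_matroid = matroid E indep
  for E :: "'a set" and indep :: "'a set \<Rightarrow> bool" +
  fixes r :: "'a rel"  \<comment> \<open>the reflexive form of the total order: \<open>(x, y) \<in> r\<close> iff \<open>x \<le> y\<close>\<close>
  assumes linear: "linear_order_on E r"
begin

definition broken_circuit :: "'a set \<Rightarrow> bool" where
  "broken_circuit X \<longleftrightarrow>
     (\<exists>C m. circuit C \<and> m \<in> C \<and> (\<forall>x\<in>C. (m, x) \<in> r) \<and> X = C - {m})"

definition nbc_basis :: "'a set \<Rightarrow> bool" where
  "nbc_basis B \<longleftrightarrow> basis B \<and> (\<forall>X. broken_circuit X \<longrightarrow> \<not> X \<subseteq> B)"

definition internally_passive :: "'a set \<Rightarrow> 'a set" where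
  "internally_passive B =
     {b \<in> B. \<exists>b'. (b', b) \<in> r \<and> b' \<noteq> b \<and> basis ((B - {b}) \<union> {b'})}"

definition int_order :: "'a set rel" where
  "int_order =
     {(B, B'). basis B \<and> basis B' \<and> internally_passive B \<subseteq> internally_passive B'}"

lemma int_order_antisym_aux:
  assumes "basis B" "basis B'" "internally_passive B = internally_passive B'"
    "e \<in> B - B'" and min: "\<forall>x \<in> B' - B. (e, x) \<in> r"
  shows False
proof -
  obtain f where f: "f \<in> B' - B" "basis (insert e (B' - {f}))"
    using basis_exchange assms by blast
  then have "f \<in> internally_passive B'"
    using min assms(4) unfolding internally_passive_def by auto
  then show False using assms(3) f unfolding internally_passive_def by auto
qed

lemma partial_order_int_order: "partial_order_on {B. basis B} int_order"
proof -
  have "B = B'"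
    if b: "basis B" "basis B'" and eq: "internally_passive B = internally_passive B'" for B B'
  proof (rule ccontr)
    assume "B \<noteq> B'"
    let ?D = "(B - B') \<union> (B' - B)"
    have sub: "?D \<subseteq> E" using b indep_ground unfolding basis_def by blast
    then have "finite ?D" using finite_ground finite_subset by blast
    moreover have "?D \<noteq> {}" using \<open>B \<noteq> B'\<close> by blast
    moreover have "\<exists>e\<in>D. \<forall>x\<in>D. (e, x) \<in> r" if "finite D" "D \<noteq> {}" "D \<subseteq> E" for D
      using that
    proof (induction rule: finite_ne_induct)
      case (singleton x)
      then show ?case using linear by (auto simp: order_on_defs refl_on_def)
    next
      case (insert x F)
      then obtain e where e: "e \<in> F" "\<forall>y\<in>F. (e, y) \<in> r" by auto
      have "(x, e) \<in> r \<or> (e, x) \<in> r" "(x, x) \<in> r"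
        using linear insert e by (auto simp: order_on_defs refl_on_def total_on_def)
      moreover have "trans r" using linear by (simp add: order_on_defs)
      ultimately have "(\<forall>y\<in>insert x F. (x, y) \<in> r) \<or> (\<forall>y\<in>insert x F. (e, y) \<in> r)"
        using e transD[of r x e] by auto
      then show ?case using e by auto
    qed
    ultimately have "\<exists>e\<in>?D. \<forall>x\<in>?D. (e, x) \<in> r" using sub by presburger
    then obtain e where "e \<in> ?D" "\<forall>x\<in>?D. (e, x) \<in> r" by blast
    then show False
      using int_order_antisym_aux[OF b eq] int_order_antisym_aux[OF b(2,1) eq[symmetric]]
      by blast
  qed
  then show ?thesis
    unfolding order_on_defs int_order_def
    by (auto simp: refl_on_def trans_def antisym_def)
qed

end

definition order_ideal :: "'b set \<Rightarrow> 'b rel \<Rightarrow> 'b set \<Rightarrow> bool" where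
  "order_ideal P le I \<longleftrightarrow> I \<subseteq> P \<and> (\<forall>y\<in>I. \<forall>x\<in>P. (x, y) \<in> le \<longrightarrow> x \<in> I)"

end

theory Submission
  imports Defs
begin

text \<open>If a basis \<open>B\<close> contains a broken circuit \<open>C - {m}\<close>, then every \<open>b \<in> C - {m}\<close> can be
  exchanged for the smaller element \<open>m\<close>, so \<open>C - {m} \<subseteq> IP(B)\<close>. Thus a broken circuit contained in
  \<open>B\<close> is contained in every basis above \<open>B\<close>.\<close>

context matroid
begin

text \<open>Augment the independent set \<open>C - {b}\<close> from \<open>B\<close> up to the size
  of \<open>B\<close>. The result cannot contain \<open>b\<close>, as it would then contain
  \<open>C\<close>, and counting leaves only \<open>insert m (B - {b})\<close>.\<close>

lemma basis_circuit_exchange: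
  assumes B: "basis B" and C: "circuit C" and m: "m \<in> C" "C - {m} \<subseteq> B" and b: "b \<in> C - {m}"
  shows "basis (insert m (B - {b}))"
proof -
  have iB: "indep B" using B by (simp add: basis_def)
  have X: "indep (C - {b})" using C b unfolding circuit_def by blast
  have "\<not> C \<subseteq> B" using C iB indep_subset unfolding circuit_def by blast
  then have mB: "m \<notin> B" using m by blast
  have bB: "b \<in> B" using m b by blast
  obtain Y where Y: "indep Y" "C - {b} \<subseteq> Y" "Y \<subseteq> (C - {b}) \<union> B" "card Y = card B"
    using extend[OF X iB indep_card_le_basis[OF B X]] by blast
  have "\<not> C \<subseteq> Y" using C Y(1) indep_subset unfolding circuit_def by blast
  then have "b \<notin> Y" using Y(2) by blast
  then have "Y \<subseteq> insert m (B - {b})" using Y(3) m by blast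
  moreover have fin: "finite B" using iB by (rule indep_finite)
  \<comment> \<open>Since \<open>m \<notin> B\<close> and \<open>b \<in> B\<close>, the swap
    preserves size, which turns the inclusion of \<open>Y\<close> into equality.\<close>
  moreover have "card (insert m (B - {b})) = card Y"
    using fin mB bB Y(4) card_Suc_Diff1[of B b] by simp
  ultimately have "Y = insert m (B - {b})" by (intro card_subset_eq) auto
  then show ?thesis using basis_if_card[OF B Y(1,4)] by simp
qed

end

context ordered_matroid
begin

lemma broken_circuit_subset_internally_passive:
  assumes "basis B" "broken_circuit X" "X \<subseteq> B"
  shows "X \<subseteq> internally_passive B"
proof
  fix b assume b: "b \<in> X"
  obtain C m where C: "circuit C" "m \<in> C" "\<forall>x\<in>C. (m, x) \<in> r" "X = C - {m}"
    using assms(2) unfolding broken_circuit_def by blast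
  then have "basis (insert m (B - {b}))"
    using basis_circuit_exchange assms b by blast
  \<comment> \<open>The witness is \<open>m\<close>: it is minimal in \<open>C\<close> and differs
    from \<open>b\<close>.\<close>
  then show "b \<in> internally_passive B"
    using C b assms(3) unfolding internally_passive_def by auto
qed

lemma nbc_basis_downward_closed:
  assumes "nbc_basis B'" "(B, B') \<in> int_order"
  shows "nbc_basis B"
proof -
  have B: "basis B" and "internally_passive B \<subseteq> internally_passive B'"
    using assms(2) by (auto simp: int_order_def)
  moreover have "internally_passive B' \<subseteq> B'" by (auto simp: internally_passive_def)
  \<comment> \<open>The chain is \<open>X \<subseteq> internally_passive B \<subseteq>
    internally_passive B' \<subseteq> B'\<close>, so a broken circuit in \<open>B\<close> would also
    spoil \<open>B'\<close>.\<close>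
  ultimately have "X \<subseteq> B'" if "broken_circuit X" "X \<subseteq> B" for X
    using broken_circuit_subset_internally_passive[OF B that] by blast
  then show ?thesis using B assms(1) unfolding nbc_basis_def by blast
qed

end

theorem theorem4p1:
  fixes E :: "'a set" and indep :: "'a set \<Rightarrow> bool" and r :: "'a rel"
  assumes "ordered_matroid E indep r"
    and "matroid.loopless E indep"
  shows "order_ideal {B. matroid.basis indep B}
           (ordered_matroid.int_order indep r)
           {B. ordered_matroid.nbc_basis E indep r B}"
proof -
  interpret ordered_matroid E indep r by fact
  have "basis B" if "nbc_basis B" for B
    using that by (simp add: nbc_basis_def)
  then show ?thesis
    using nbc_basis_downward_closed unfolding order_ideal_def by blast
qed

end
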